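(* Let $F$ be a singular fiber of Kodaira type $II^*$ of an elliptic fibration on a smooth $K3$ surface, written $$F=6C+3S_1+4M_1+2M_2+5L_1+4L_2+3L_3+2L_4+L_5.$$ Let $R$ be an ADER in $F$ with $C\not\subset\operatorname{Supp}(R)$. Then $R$ decomposes uniquely as a disjoint sum $$R=R_S+R_M+R_L,$$ where $R_S\in\{0,S_1\}$, and $R_M$ and $R_L$ are either zero or disjoint unions of mutually disjoint consecutive subchains of $M_1-M_2$ and $L_1-L_2-L_3-L_4-L_5$, respectively. (1) If $R_M\neq0$, then $R_M$ is of type $A_{\mu_1}\oplus\cdots\oplus A_{\mu_a}$ for some $\mu_1,\dots,\mu_a\geq1$ satisfying $\sum_{i=1}^a\mu_i+a-1\leq2$. (2) If $R_L\neq0$, then $R_L$ is of type $A_{\lambda_1}\oplus\cdots\oplus A_{\lambda_b}$ for some $\lambda_1,\dots,\lambda_b\geq1$ satisfying $\sum_{j=1}^b\lambda_j+b-1\leq5$. Conversely, every nonzero reduced subdivisor of $F$ of the form $R_S+R_M+R_L$, with $R_S\in\{0,S_1\}$, and with $R_M$ and $R_L$ each either zero or a disjoint union of mutually disjoint consecutive subchains of $M_1-M_2$ and $L_1-L_2-L_3-L_4-L_5$, respectively, satisfying (1) and (2), is an ADER.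
   Context: We work over an algebraically closed field of characteristic $0$. In a fiber of type $II^*$ all components are smooth rational $(-2)$-curves, meeting transversely in at most one point, with dual graph $\widetilde E_8$: the central vertex $C$ is the unique component meeting three others, and three branches start at $C$: $C-S_1$, $C-M_1-M_2$, and $C-L_1-L_2-L_3-L_4-L_5$. An ADE reduced divisor (ADER) in $F$ is a nonzero reduced subdivisor of $F$ (a sum of distinct components) whose dual graph is a disjoint union of Dynkin diagrams of type $A_k$, $D_l$ ($l\ge4$), $E_6,E_7,E_8$; its type is the type of this graph, with $\oplus$ denoting disjoint union. Mutually disjoint consecutive subchains are pairwise separated by at least one unused vertex. *)

theory Defs
  imports "HOL-Analysis.Analysis" "HOL-Computational_Algebra.Polynomial"
begin

section \<open>Classical projective varieties\<close>

text \<open>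
  A point is a line through the origin, minus the origin, in the space of finitely supported
  sequences.  The projective space of dimension \<open>N\<close> is the set of lines of vectors supported
  on \<open>{..N}\<close>; its usual Zariski topology is the one induced from all points, because forms
  restrict to forms.  Over an infinite field \<open>form d\<close> describes exactly the functions given by
  homogeneous polynomials of degree \<open>d\<close>.
\<close>

type_synonym 'k pt = "(nat \<Rightarrow> 'k) set"
type_synonym 'k fn = "'k pt \<Rightarrow> 'k"

definition line :: "(nat \<Rightarrow> 'k::field) \<Rightarrow> 'k pt" where
  "line v = {(\<lambda>i. c * v i) | c. c \<noteq> 0}"

definition points :: "'k::field pt set" where
  "points = {line v | v. finite {i. v i \<noteq> 0} \<and> (\<exists>i. v i \<noteq> 0)}"

definition proj_space :: "nat \<Rightarrow> 'k::field pt set" where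
  "proj_space N = {line v | v. (\<forall>i>N. v i = 0) \<and> (\<exists>i. v i \<noteq> 0)}"

inductive form :: "nat \<Rightarrow> ((nat \<Rightarrow> 'k::field) \<Rightarrow> 'k) \<Rightarrow> bool" where
  const: "form 0 (\<lambda>_. c)"
| coord: "form 1 (\<lambda>x. x i)"
| add: "form d f \<Longrightarrow> form d g \<Longrightarrow> form d (\<lambda>x. f x + g x)"
| mult: "form d f \<Longrightarrow> form e g \<Longrightarrow> form (d + e) (\<lambda>x. f x * g x)"

definition zariski :: "'k::field pt topology" where
  "zariski = topology_generated_by {{P \<in> points. \<exists>x\<in>P. f x \<noteq> 0} | f. \<exists>d. form d f}"

abbreviation ztop :: "'k::field pt set \<Rightarrow> 'k pt topology" where
  "ztop X \<equiv> subtopology zariski X"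

definition irreducible_set :: "'k::field pt set \<Rightarrow> bool" where
  "irreducible_set Y \<longleftrightarrow> Y \<noteq> {} \<and>
     (\<forall>Z Z'. closedin zariski Z \<and> closedin zariski Z' \<and> Y \<subseteq> Z \<union> Z' \<longrightarrow> Y \<subseteq> Z \<or> Y \<subseteq> Z')"

definition projective_variety :: "'k::field pt set \<Rightarrow> bool" where
  "projective_variety X \<longleftrightarrow> (\<exists>N. X \<subseteq> proj_space N) \<and> closedin zariski X \<and> irreducible_set X"

definition irreducible_chain :: "'k::field pt set \<Rightarrow> nat \<Rightarrow> (nat \<Rightarrow> 'k pt set) \<Rightarrow> bool" where
  "irreducible_chain X d Z \<longleftrightarrow>
     (\<forall>i\<le>d. closedin (ztop X) (Z i) \<and> irreducible_set (Z i)) \<and> (\<forall>i<d. Z i \<subset> Z (Suc i))"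

definition krull_dim :: "'k::field pt set \<Rightarrow> nat \<Rightarrow> bool" where
  "krull_dim X d \<longleftrightarrow> (\<exists>Z. irreducible_chain X d Z) \<and> \<not> (\<exists>Z. irreducible_chain X (Suc d) Z)"

text \<open>Functions are total; only the values on the open set \<open>U\<close> matter.\<close>

definition regular :: "'k::field pt set \<Rightarrow> 'k pt set \<Rightarrow> 'k fn set" where
  "regular X U = {h. \<forall>p\<in>U. \<exists>V. openin (ztop X) V \<and> p \<in> V \<and> V \<subseteq> U \<and>
     (\<exists>d f g. form d f \<and> form d g \<and> (\<forall>q\<in>V. \<forall>x\<in>q. g x \<noteq> 0 \<and> h q = f x / g x))}"

definition morphism :: "'k::field pt set \<Rightarrow> 'k pt set \<Rightarrow> ('k pt \<Rightarrow> 'k pt) \<Rightarrow> bool" where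
  "morphism X Y \<phi> \<longleftrightarrow> continuous_map (ztop X) (ztop Y) \<phi> \<and>
     (\<forall>U h. openin (ztop Y) U \<and> h \<in> regular Y U \<longrightarrow> h \<circ> \<phi> \<in> regular X {p \<in> X. \<phi> p \<in> U})"

definition isomorphic_varieties :: "'k::field pt set \<Rightarrow> 'k pt set \<Rightarrow> bool" where
  "isomorphic_varieties X Y \<longleftrightarrow> (\<exists>\<phi> \<psi>. morphism X Y \<phi> \<and> morphism Y X \<psi> \<and>
     (\<forall>p\<in>X. \<psi> (\<phi> p) = p) \<and> (\<forall>q\<in>Y. \<phi> (\<psi> q) = q))"


section \<open>Local rings\<close>

text \<open>
  \<open>stalk X p\<close> and \<open>ideal_at X Y p\<close> consist of representatives of germs at \<open>p\<close>: of the regular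
  functions on \<open>X\<close>, and of those vanishing on \<open>Y\<close>.  In particular \<open>ideal_at X {p} p\<close> represents
  the maximal ideal.
\<close>

definition stalk :: "'k::field pt set \<Rightarrow> 'k pt \<Rightarrow> 'k fn set" where
  "stalk X p = {f. \<exists>U. openin (ztop X) U \<and> p \<in> U \<and> f \<in> regular X U}"

definition eq_near :: "'k::field pt set \<Rightarrow> 'k pt \<Rightarrow> 'k fn \<Rightarrow> 'k fn \<Rightarrow> bool" where
  "eq_near X p f g \<longleftrightarrow> (\<exists>U. openin (ztop X) U \<and> p \<in> U \<and> (\<forall>q\<in>U. f q = g q))"

definition ideal_at :: "'k::field pt set \<Rightarrow> 'k pt set \<Rightarrow> 'k pt \<Rightarrow> 'k fn set" where
  "ideal_at X Y p =
     {f. \<exists>U. openin (ztop X) U \<and> p \<in> U \<and> f \<in> regular X U \<and> (\<forall>q\<in>U \<inter> Y. f q = 0)}"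

definition local_generators ::
    "'k::field pt set \<Rightarrow> 'k pt set \<Rightarrow> 'k pt \<Rightarrow> 'k fn set \<Rightarrow> bool" where
  "local_generators X Y p T \<longleftrightarrow> finite T \<and> T \<subseteq> ideal_at X Y p \<and>
     (\<forall>f\<in>ideal_at X Y p. \<exists>a. (\<forall>t\<in>T. a t \<in> stalk X p) \<and>
        eq_near X p f (\<lambda>q. \<Sum>t\<in>T. a t q * t q))"

text \<open>Smoothness: every local ring is regular.\<close>

definition smooth_projective :: "nat \<Rightarrow> 'k::field pt set \<Rightarrow> bool" where
  "smooth_projective d X \<longleftrightarrow> projective_variety X \<and> krull_dim X d \<and>
     (\<forall>p\<in>X. \<exists>T. card T = d \<and> local_generators X {p} p T)"


section \<open>Differential forms, K3 surfaces, elliptic fibrations\<close>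

text \<open>
  Elements of the Zariski tangent space at \<open>p\<close>, as point derivations of the local ring.  On a
  smooth variety a regular differential form is determined by its values on tangent vectors.
\<close>

definition derivation :: "'k::field pt set \<Rightarrow> 'k pt \<Rightarrow> ('k fn \<Rightarrow> 'k) \<Rightarrow> bool" where
  "derivation X p \<delta> \<longleftrightarrow>
     (\<forall>c. \<delta> (\<lambda>_. c) = 0) \<and>
     (\<forall>f\<in>stalk X p. \<forall>g\<in>stalk X p.
        \<delta> (\<lambda>q. f q + g q) = \<delta> f + \<delta> g \<and>
        \<delta> (\<lambda>q. f q * g q) = f p * \<delta> g + g p * \<delta> f \<and>
        (eq_near X p f g \<longrightarrow> \<delta> f = \<delta> g))"

definition regular_1form ::
    "'k::field pt set \<Rightarrow> ('k pt \<Rightarrow> ('k fn \<Rightarrow> 'k) \<Rightarrow> 'k) \<Rightarrow> bool" where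
  "regular_1form X \<theta> \<longleftrightarrow> (\<forall>p\<in>X. \<exists>U n a f. openin (ztop X) U \<and> p \<in> U \<and>
     (\<forall>i<n. a i \<in> regular X U \<and> f i \<in> regular X U) \<and>
     (\<forall>q\<in>U. \<forall>\<delta>. derivation X q \<delta> \<longrightarrow> \<theta> q \<delta> = (\<Sum>i<(n::nat). a i q * \<delta> (f i))))"

definition regular_2form ::
    "'k::field pt set \<Rightarrow> ('k pt \<Rightarrow> ('k fn \<Rightarrow> 'k) \<Rightarrow> ('k fn \<Rightarrow> 'k) \<Rightarrow> 'k) \<Rightarrow> bool" where
  "regular_2form X \<omega> \<longleftrightarrow> (\<forall>p\<in>X. \<exists>U n a f g. openin (ztop X) U \<and> p \<in> U \<and>
     (\<forall>i<n. a i \<in> regular X U \<and> f i \<in> regular X U \<and> g i \<in> regular X U) \<and>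
     (\<forall>q\<in>U. \<forall>\<delta> \<epsilon>. derivation X q \<delta> \<and> derivation X q \<epsilon> \<longrightarrow>
        \<omega> q \<delta> \<epsilon> = (\<Sum>i<(n::nat). a i q * (\<delta> (f i) * \<epsilon> (g i) - \<delta> (g i) * \<epsilon> (f i)))))"

definition trivial_canonical_bundle :: "'k::field pt set \<Rightarrow> bool" where
  "trivial_canonical_bundle X \<longleftrightarrow> (\<exists>\<omega>. regular_2form X \<omega> \<and>
     (\<forall>p\<in>X. \<exists>\<delta> \<epsilon>. derivation X p \<delta> \<and> derivation X p \<epsilon> \<and> \<omega> p \<delta> \<epsilon> \<noteq> 0))"

text \<open>
  Vanishing of the first cohomology of the structure sheaf, in Cech form.  Finite covers suffice by
  quasi-compactness, and no refinement is needed because the first Cech cohomology of any cover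
  embeds into sheaf cohomology.
\<close>

definition H1_structure_sheaf_zero :: "'k::field pt set \<Rightarrow> bool" where
  "H1_structure_sheaf_zero X \<longleftrightarrow> (\<forall>(n::nat) U g.
     (\<forall>i<n. openin (ztop X) (U i)) \<and> (\<Union>i<n. U i) = X \<and>
     (\<forall>i<n. \<forall>j<n. g i j \<in> regular X (U i \<inter> U j)) \<and>
     (\<forall>i<n. \<forall>j<n. \<forall>k<n. \<forall>p\<in>U i \<inter> U j \<inter> U k. g i j p + g j k p = g i k p) \<longrightarrow>
     (\<exists>h. (\<forall>i<n. h i \<in> regular X (U i)) \<and>
          (\<forall>i<n. \<forall>j<n. \<forall>p\<in>U i \<inter> U j. g i j p = h i p - h j p)))"

definition K3_surface :: "'k::field pt set \<Rightarrow> bool" where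
  "K3_surface X \<longleftrightarrow>
     smooth_projective 2 X \<and> trivial_canonical_bundle X \<and> H1_structure_sheaf_zero X"

text \<open>Genus one: the space of global regular 1-forms is one-dimensional.\<close>

definition smooth_genus_one_curve :: "'k::field pt set \<Rightarrow> bool" where
  "smooth_genus_one_curve Y \<longleftrightarrow> smooth_projective 1 Y \<and>
     (\<exists>\<theta>. regular_1form Y \<theta> \<and> (\<exists>p\<in>Y. \<exists>\<delta>. derivation Y p \<delta> \<and> \<theta> p \<delta> \<noteq> 0) \<and>
       (\<forall>\<eta>. regular_1form Y \<eta> \<longrightarrow>
          (\<exists>c. \<forall>p\<in>Y. \<forall>\<delta>. derivation Y p \<delta> \<longrightarrow> \<eta> p \<delta> = c * \<theta> p \<delta>)))"

definition fiber_set :: "'k::field pt set \<Rightarrow> ('k pt \<Rightarrow> 'k pt) \<Rightarrow> 'k pt \<Rightarrow> 'k pt set" where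
  "fiber_set X \<pi> b = {p \<in> X. \<pi> p = b}"

text \<open>
  All but finitely many scheme-theoretic fibers are smooth curves of genus one; the last clause says
  that such a fiber is reduced.  No section is required.
\<close>

definition elliptic_fibration ::
    "'k::field pt set \<Rightarrow> 'k pt set \<Rightarrow> ('k pt \<Rightarrow> 'k pt) \<Rightarrow> bool" where
  "elliptic_fibration X B \<pi> \<longleftrightarrow>
     smooth_projective 1 B \<and> morphism X B \<pi> \<and> \<pi> ` X = B \<and>
     finite {b \<in> B. \<not> (smooth_genus_one_curve (fiber_set X \<pi> b) \<and>
       (\<forall>p\<in>fiber_set X \<pi> b. \<exists>t. local_generators B {b} b {t} \<and>
          local_generators X (fiber_set X \<pi> b) p {t \<circ> \<pi>}))}"


section \<open>Fibers as divisors\<close>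

text \<open>An effective divisor is a multiset of curves.\<close>

type_synonym 'k eff_divisor = "'k pt set multiset"

definition irreducible_components :: "'k::field pt set \<Rightarrow> 'k pt set set" where
  "irreducible_components Y =
     {Z. Z \<subseteq> Y \<and> closedin zariski Z \<and> irreducible_set Z \<and>
         (\<forall>Z'. Z \<subseteq> Z' \<and> Z' \<subseteq> Y \<and> closedin zariski Z' \<and> irreducible_set Z' \<longrightarrow> Z' = Z)}"

text \<open>
  Order of vanishing \<open>n\<close> of \<open>f\<close> along a curve \<open>Z\<close> on a smooth surface: at a general point of \<open>Z\<close>,
  \<open>f\<close> is a unit times the \<open>n\<close>-th power of a local equation of \<open>Z\<close>.
\<close>

definition vanishing_order ::
    "'k::field pt set \<Rightarrow> 'k pt set \<Rightarrow> 'k fn \<Rightarrow> nat \<Rightarrow> bool" where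
  "vanishing_order X Z f n \<longleftrightarrow> (\<exists>p\<in>Z. \<exists>e u. local_generators X Z p {e} \<and>
     u \<in> stalk X p \<and> u p \<noteq> 0 \<and> eq_near X p f (\<lambda>q. u q * e q ^ n))"

definition is_fiber ::
    "'k::field pt set \<Rightarrow> 'k pt set \<Rightarrow> ('k pt \<Rightarrow> 'k pt) \<Rightarrow> 'k pt \<Rightarrow> 'k eff_divisor \<Rightarrow> bool" where
  "is_fiber X B \<pi> b F \<longleftrightarrow> b \<in> B \<and> set_mset F = irreducible_components (fiber_set X \<pi> b) \<and>
     (\<forall>Z\<in>#F. \<exists>t. local_generators B {b} b {t} \<and> vanishing_order X Z (t \<circ> \<pi>) (count F Z))"

definition smooth_rational_curve :: "'k::field pt set \<Rightarrow> bool" where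
  "smooth_rational_curve Z \<longleftrightarrow> projective_variety Z \<and> isomorphic_varieties (proj_space 1) Z"

text \<open>
  Self-intersection of a smooth curve \<open>Z\<close> on a smooth surface: minus the degree of the conormal
  bundle.  The degree is computed from a rational section, the class of a function \<open>g\<close> that is an
  equation of \<open>Z\<close> on an open set \<open>U\<close> meeting \<open>Z\<close>.  At \<open>p\<close>, with \<open>e\<close> a local equation of \<open>Z\<close>, the
  order of this section is the order at \<open>p\<close> of the rational function that \<open>w = g / e\<close> induces on \<open>Z\<close>.
\<close>

definition self_intersection :: "'k::field pt set \<Rightarrow> 'k pt set \<Rightarrow> int \<Rightarrow> bool" where
  "self_intersection X Z n \<longleftrightarrow> (\<exists>g U (m :: 'k pt \<Rightarrow> int).
     openin (ztop X) U \<and> U \<inter> Z \<noteq> {} \<and> g \<in> regular X U \<and>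
     (\<forall>p\<in>U \<inter> Z. local_generators X Z p {g}) \<and>
     (\<forall>p\<in>Z. \<exists>e t v V. local_generators X Z p {e} \<and> local_generators Z {p} p {t} \<and>
        v \<in> stalk Z p \<and> v p \<noteq> 0 \<and> openin (ztop X) V \<and> p \<in> V \<and>
        (\<forall>q\<in>U \<inter> V \<inter> Z - {p}. \<exists>w\<in>stalk X q.
           eq_near X q g (\<lambda>r. w r * e r) \<and> w q = v q * t q powi m p)) \<and>
     finite {p \<in> Z. m p \<noteq> 0} \<and> n = - (\<Sum>p\<in>{p \<in> Z. m p \<noteq> 0}. m p))"

definition transversal_at :: "'k::field pt set \<Rightarrow> 'k pt set \<Rightarrow> 'k pt set \<Rightarrow> 'k pt \<Rightarrow> bool" where
  "transversal_at X Y Z p \<longleftrightarrow> (\<exists>y z. local_generators X Y p {y} \<and>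
     local_generators X Z p {z} \<and> local_generators X {p} p {y, z})"

text \<open>The dual graph of a divisor \<open>R\<close> has vertex set \<open>set_mset R\<close>.\<close>

definition dual_edges :: "'k eff_divisor \<Rightarrow> 'k pt set set set" where
  "dual_edges R = {{Y, Z} | Y Z. Y \<in># R \<and> Z \<in># R \<and> Y \<noteq> Z \<and> Y \<inter> Z \<noteq> {}}"

definition E8_tilde ::
    "'a set \<Rightarrow> 'a set set \<Rightarrow> 'a \<Rightarrow> 'a \<Rightarrow> 'a \<Rightarrow> 'a \<Rightarrow> 'a \<Rightarrow> 'a \<Rightarrow> 'a \<Rightarrow> 'a \<Rightarrow> 'a \<Rightarrow> bool" where
  "E8_tilde V E C S1 M1 M2 L1 L2 L3 L4 L5 \<longleftrightarrow>
     distinct [C, S1, M1, M2, L1, L2, L3, L4, L5] \<and>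
     V = {C, S1, M1, M2, L1, L2, L3, L4, L5} \<and>
     E = {{C, S1}, {C, M1}, {M1, M2}, {C, L1}, {L1, L2}, {L2, L3}, {L3, L4}, {L4, L5}}"

definition type_II_star :: "'k::field pt set \<Rightarrow> 'k eff_divisor \<Rightarrow> bool" where
  "type_II_star X F \<longleftrightarrow>
     (\<forall>Z\<in>#F. smooth_rational_curve Z \<and> self_intersection X Z (-2)) \<and>
     (\<forall>Y\<in>#F. \<forall>Z\<in>#F. Y \<noteq> Z \<longrightarrow>
        (\<forall>p\<in>Y \<inter> Z. transversal_at X Y Z p \<and> (\<forall>q\<in>Y \<inter> Z. q = p))) \<and>
     (\<exists>C S1 M1 M2 L1 L2 L3 L4 L5.
        E8_tilde (set_mset F) (dual_edges F) C S1 M1 M2 L1 L2 L3 L4 L5)"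


section \<open>ADE reduced divisors\<close>

datatype dynkin = Dynkin_A nat | Dynkin_D nat | Dynkin_E nat

fun dynkin_valid :: "dynkin \<Rightarrow> bool" where
  "dynkin_valid (Dynkin_A n) \<longleftrightarrow> n \<ge> 1"
| "dynkin_valid (Dynkin_D n) \<longleftrightarrow> n \<ge> 4"
| "dynkin_valid (Dynkin_E n) \<longleftrightarrow> n \<in> {6, 7, 8}"

fun dynkin_verts :: "dynkin \<Rightarrow> nat set" where
  "dynkin_verts (Dynkin_A n) = {..<n}"
| "dynkin_verts (Dynkin_D n) = {..<n}"
| "dynkin_verts (Dynkin_E n) = {..<n}"

text \<open>
  In types D and E the vertices \<open>0, ..., n - 2\<close> form a path, and the vertex \<open>n - 1\<close> is attached to
  the last but one vertex of this path (type D), respectively to its third vertex (type E).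
\<close>

fun dynkin_edges :: "dynkin \<Rightarrow> nat set set" where
  "dynkin_edges (Dynkin_A n) = {{i, i + 1} | i. i + 1 < n}"
| "dynkin_edges (Dynkin_D n) = {{i, i + 1} | i. i + 2 < n} \<union> {{n - 3, n - 1}}"
| "dynkin_edges (Dynkin_E n) = {{i, i + 1} | i. i + 2 < n} \<union> {{2, n - 1}}"

text \<open>The graph \<open>(V, E)\<close> is isomorphic to the disjoint union of the diagrams in the list.\<close>

definition graph_type :: "'a set \<Rightarrow> 'a set set \<Rightarrow> dynkin list \<Rightarrow> bool" where
  "graph_type V E ts \<longleftrightarrow>
     (\<exists>\<phi>. bij_betw \<phi> (SIGMA i:{..<length ts}. dynkin_verts (ts ! i)) V \<and>
          E = {(\<lambda>v. \<phi> (i, v)) ` e | i e. i < length ts \<and> e \<in> dynkin_edges (ts ! i)})"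

definition divisor_type :: "'k eff_divisor \<Rightarrow> dynkin list \<Rightarrow> bool" where
  "divisor_type R ts \<longleftrightarrow> graph_type (set_mset R) (dual_edges R) ts"

definition reduced_subdivisor :: "'k eff_divisor \<Rightarrow> 'k eff_divisor \<Rightarrow> bool" where
  "reduced_subdivisor F R \<longleftrightarrow> R \<subseteq># F \<and> (\<forall>Z. count R Z \<le> 1)"

definition ADER :: "'k eff_divisor \<Rightarrow> 'k eff_divisor \<Rightarrow> bool" where
  "ADER F R \<longleftrightarrow> R \<noteq> {#} \<and> reduced_subdivisor F R \<and>
     (\<exists>ts. (\<forall>t\<in>set ts. dynkin_valid t) \<and> divisor_type R ts)"

text \<open>
  \<open>R\<close> is the sum of the vertices of mutually disjoint consecutive subchains of the chain \<open>xs\<close>, any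
  two of them separated by an unused vertex.  The subchains are given by their intervals of indices;
  no subchains at all means that \<open>R\<close> is zero.
\<close>

definition subchain_union :: "'a list \<Rightarrow> 'a multiset \<Rightarrow> bool" where
  "subchain_union xs R \<longleftrightarrow> (\<exists>K :: nat set set.
     (\<forall>I\<in>K. \<exists>i j. i \<le> j \<and> j < length xs \<and> I = {i..j}) \<and>
     disjoint K \<and>
     (\<forall>I\<in>K. \<forall>J\<in>K. I \<noteq> J \<longrightarrow> (\<forall>i\<in>I. \<forall>j\<in>J. i < j \<longrightarrow> (\<exists>k. i < k \<and> k < j \<and> k \<notin> \<Union>K))) \<and>
     R = mset_set ((!) xs ` \<Union>K))"

definition disjoint_divisors :: "'k eff_divisor \<Rightarrow> 'k eff_divisor \<Rightarrow> bool" where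
  "disjoint_divisors R R' \<longleftrightarrow> (\<forall>Y\<in>#R. \<forall>Z\<in>#R'. Y \<inter> Z = {})"

end

theory Submission
  imports Defs
begin

text \<open>
  Deleting the central component leaves three chains that do not meet each other, so only the
  incidence relation of the components matters.  Any set of vertices of a chain is the union of its
  maximal runs of consecutive vertices, and a run of \<open>k\<close> vertices spans a diagram of type \<open>A\<^sub>k\<close>.
  Counting one unused vertex after each run but the last one bounds the sum of the lengths.
\<close>

section \<open>Runs of consecutive indices\<close>

text \<open>
  Induction along the runs of \<open>A\<close>: the greatest unused index \<open>m\<close> below \<open>n\<close> splits off the last run.
\<close>

lemma interval_run_induct [consumes 1, case_names initial skip run]:
  fixes A :: "nat set"
  assumes "A \<subseteq> {..<n}"
    and initial: "\<And>n. P n {..<n}"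
    and skip: "\<And>n A. A \<subseteq> {..<n} \<Longrightarrow> P n A \<Longrightarrow> P (Suc n) A"
    and run: "\<And>m n A. A \<subseteq> {..<m} \<Longrightarrow> P m A \<Longrightarrow> Suc m < n \<Longrightarrow> P n (A \<union> {Suc m..<n})"
  shows "P n A"
  using assms(1)
proof (induction n arbitrary: A rule: less_induct)
  case (less n)
  show ?case
  proof (cases "A = {..<n}")
    case True
    then show ?thesis using initial by simp
  next
    case False
    define m where "m = Max ({..<n} - A)"
    have ne: "{..<n} - A \<noteq> {}" using False less.prems by blast
    have "m \<in> {..<n} - A" unfolding m_def using ne by (intro Max_in) auto
    then have m: "m < n" "m \<notin> A" by auto
    have above: "k \<in> A" if "m < k" "k < n" for k
    proof (rule ccontr)
      assume "k \<notin> A"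
      then have "k \<le> m" unfolding m_def using that by (intro Max_ge) auto
      with that show False by simp
    qed
    have sub: "A \<inter> {..<m} \<subseteq> {..<m}" by simp
    have P: "P m (A \<inter> {..<m})" using less.IH[OF m(1) sub] .
    have A: "A = A \<inter> {..<m} \<union> {Suc m..<n}"
    proof
      show "A \<subseteq> A \<inter> {..<m} \<union> {Suc m..<n}"
      proof
        fix x assume "x \<in> A"
        with m less.prems have "x \<noteq> m" "x < n" by auto
        with \<open>x \<in> A\<close> show "x \<in> A \<inter> {..<m} \<union> {Suc m..<n}" by auto
      qed
    qed (use above in auto)
    show ?thesis
    proof (cases "Suc m < n")
      case True
      then show ?thesis using run[OF sub P True] by (simp only: A[symmetric])
    next
      case False
      then have "n = Suc m" using m by simp
      moreover from this have "A = A \<inter> {..<m}" using A by auto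
      ultimately show ?thesis using skip[OF sub P] by metis
    qed
  qed
qed

section \<open>Dynkin types of induced subgraphs of a path\<close>

lemma graph_type_Nil: "graph_type {} {} []"
  by (auto simp: graph_type_def bij_betw_def)

lemma graph_type_image:
  assumes "graph_type V E ts" "inj_on f V"
  shows "graph_type (f ` V) ((`) f ` E) ts"
proof -
  from assms(1) obtain \<phi> where
    \<phi>: "bij_betw \<phi> (SIGMA i:{..<length ts}. dynkin_verts (ts ! i)) V"
    and E: "E = {(\<lambda>v. \<phi> (i, v)) ` e | i e. i < length ts \<and> e \<in> dynkin_edges (ts ! i)}"
    unfolding graph_type_def by blast
  have "bij_betw (f \<circ> \<phi>) (SIGMA i:{..<length ts}. dynkin_verts (ts ! i)) (f ` V)"
    using \<phi> assms(2) by (intro bij_betw_trans[of \<phi> _ V]) (auto simp: bij_betw_def)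
  moreover have "(`) f ` E =
      {(\<lambda>v. (f \<circ> \<phi>) (i, v)) ` e | i e. i < length ts \<and> e \<in> dynkin_edges (ts ! i)}"
  proof -
    have "(`) f ` E = {f ` (\<lambda>v. \<phi> (i, v)) ` e | i e. i < length ts \<and> e \<in> dynkin_edges (ts ! i)}"
      unfolding E by blast
    then show ?thesis by (simp add: image_image)
  qed
  ultimately show ?thesis unfolding graph_type_def by blast
qed

text \<open>Shifting the diagram indices of \<open>us\<close> by \<open>length ts\<close> makes the
  two index sets disjoint, so the two bijections can be glued. Disjointness of \<open>V\<close> and
  \<open>W\<close> keeps the glued map injective.\<close>

lemma graph_type_append:
  assumes "graph_type V E ts" "graph_type W D us" "V \<inter> W = {}"
  shows "graph_type (V \<union> W) (E \<union> D) (ts @ us)"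
proof -
  let ?S = "\<lambda>ts. SIGMA i:{..<length ts}. dynkin_verts (ts ! i)"
  let ?n = "length ts"
  from assms(1) obtain \<phi> where \<phi>: "bij_betw \<phi> (?S ts) V"
    and E: "E = {(\<lambda>v. \<phi> (i, v)) ` e | i e. i < length ts \<and> e \<in> dynkin_edges (ts ! i)}"
    unfolding graph_type_def by blast
  from assms(2) obtain \<psi> where \<psi>: "bij_betw \<psi> (?S us) W"
    and D: "D = {(\<lambda>v. \<psi> (i, v)) ` e | i e. i < length us \<and> e \<in> dynkin_edges (us ! i)}"
    unfolding graph_type_def by blast
  define \<theta> where "\<theta> = (\<lambda>(i, v). if i < ?n then \<phi> (i, v) else \<psi> (i - ?n, v))"
  let ?T = "(\<lambda>(i, v). (i + ?n, v)) ` ?S us"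
  have S: "?S (ts @ us) = ?S ts \<union> ?T"
  proof (intro set_eqI iffI)
    fix x assume x: "x \<in> ?S (ts @ us)"
    obtain i v where iv: "x = (i, v)" by (cases x)
    show "x \<in> ?S ts \<union> ?T"
    proof (cases "i < ?n")
      case True
      then show ?thesis using x iv by (auto simp: nth_append)
    next
      case False
      then have "(i - ?n, v) \<in> ?S us" using x iv by (auto simp: nth_append)
      then have "(i - ?n + ?n, v) \<in> ?T" by (intro image_eqI[of _ _ "(i - ?n, v)"]) auto
      then show ?thesis using False iv by simp
    qed
  qed (auto simp: nth_append)
  have "bij_betw \<theta> (?S ts) V"
    using \<phi> by (subst bij_betw_cong[of _ _ \<phi>]) (auto simp: \<theta>_def)
  moreover have "bij_betw \<theta> ?T W"
  proof -
    \<comment> \<open>On \<open>?T\<close> the glued map is \<open>\<psi>\<close> after undoing the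
      shift. Composed with the shift it is \<open>\<psi>\<close> again, and the shift, a bijection
      onto \<open>?T\<close>, can be cancelled.\<close>
    have "bij_betw (\<theta> \<circ> (\<lambda>(i, v). (i + ?n, v))) (?S us) W"
      using \<psi> by (subst bij_betw_cong[of _ _ \<psi>]) (auto simp: \<theta>_def)
    moreover have "bij_betw (\<lambda>(i, v). (i + ?n, v)) (?S us) ?T"
      by (auto simp: bij_betw_def inj_on_def)
    ultimately show ?thesis using bij_betw_comp_iff by blast
  qed
  ultimately have "bij_betw \<theta> (?S (ts @ us)) (V \<union> W)"
    unfolding S using assms(3) by (rule bij_betw_combine)
  moreover have "E \<union> D = {(\<lambda>v. \<theta> (i, v)) ` e | i e.
      i < length (ts @ us) \<and> e \<in> dynkin_edges ((ts @ us) ! i)}" (is "_ = ?G")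
  proof
    show "E \<union> D \<subseteq> ?G"
    proof
      fix x assume "x \<in> E \<union> D"
      then show "x \<in> ?G"
      proof
        assume "x \<in> E"
        then obtain i e where "x = (\<lambda>v. \<phi> (i, v)) ` e" "i < ?n" "e \<in> dynkin_edges (ts ! i)"
          unfolding E by blast
        then have "x = (\<lambda>v. \<theta> (i, v)) ` e \<and> i < length (ts @ us) \<and>
            e \<in> dynkin_edges ((ts @ us) ! i)"
          by (simp add: \<theta>_def nth_append)
        then show ?thesis by blast
      next
        assume "x \<in> D"
        then obtain i e where "x = (\<lambda>v. \<psi> (i, v)) ` e" "i < length us" "e \<in> dynkin_edges (us ! i)"
          unfolding D by blast
        then have "x = (\<lambda>v. \<theta> (i + ?n, v)) ` e \<and> i + ?n < length (ts @ us) \<and>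
            e \<in> dynkin_edges ((ts @ us) ! (i + ?n))"
          by (simp add: \<theta>_def nth_append)
        then show ?thesis by blast
      qed
    qed
    show "?G \<subseteq> E \<union> D"
    proof
      fix x assume "x \<in> ?G"
      then obtain i e where x: "x = (\<lambda>v. \<theta> (i, v)) ` e" "i < length (ts @ us)"
        "e \<in> dynkin_edges ((ts @ us) ! i)" by blast
      show "x \<in> E \<union> D"
      proof (cases "i < ?n")
        case True
        then have "x = (\<lambda>v. \<phi> (i, v)) ` e" "e \<in> dynkin_edges (ts ! i)"
          using x by (auto simp: \<theta>_def nth_append)
        then show ?thesis using True unfolding E by blast
      next
        case False
        then have "x = (\<lambda>v. \<psi> (i - ?n, v)) ` e" "e \<in> dynkin_edges (us ! (i - ?n))"
          "i - ?n < length us"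
          using x by (auto simp: \<theta>_def nth_append)
        then show ?thesis unfolding D by blast
      qed
    qed
  qed
  ultimately show ?thesis unfolding graph_type_def by blast
qed

text \<open>Translation by \<open>m\<close> is the isomorphism. For \<open>n = 0\<close> both sides
  are empty graphs although \<open>Dynkin_A 0\<close> is not a valid diagram; positive length is
  ensured where the lemma is applied.\<close>

lemma graph_type_interval:
  "graph_type {m..<m + n} {{i, Suc i} | i. m \<le> i \<and> Suc i < m + n} [Dynkin_A n]"
proof -
  have "bij_betw (\<lambda>(i, v). m + v) (SIGMA i:{..<length [Dynkin_A n]}.
      dynkin_verts ([Dynkin_A n] ! i)) {m..<m + n}"
    by (rule bij_betw_byWitness[of _ "\<lambda>k. (0, k - m)"]) auto
  moreover have "{{i, Suc i} | i. m \<le> i \<and> Suc i < m + n} =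
      {(\<lambda>v. (\<lambda>(i, v). m + v) (i, v)) ` e | i e. i < length [Dynkin_A n] \<and>
        e \<in> dynkin_edges ([Dynkin_A n] ! i)}" (is "?L = ?R")
  proof
    show "?L \<subseteq> ?R"
    proof
      fix e assume "e \<in> ?L"
      then obtain i where i: "e = {i, Suc i}" "m \<le> i" "Suc i < m + n" by blast
      then have "e = (\<lambda>v. (\<lambda>(i, v). m + v) (0 :: nat, v)) ` {i - m, i - m + 1}"
        and "{i - m, i - m + 1} \<in> dynkin_edges ([Dynkin_A n] ! 0)"
        by auto
      then show "e \<in> ?R" by (intro CollectI exI[of _ 0] exI[of _ "{i - m, i - m + 1}"]) simp
    qed
    show "?R \<subseteq> ?L"
    proof
      fix x assume "x \<in> ?R"
      then obtain e where "x = (\<lambda>v. m + v) ` e" "e \<in> dynkin_edges (Dynkin_A n)" by auto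
      then obtain k where "x = {m + k, Suc (m + k)}" "Suc k < n" by auto
      then show "x \<in> ?L" by (intro CollectI exI[of _ "m + k"]) simp
    qed
  qed
  ultimately show ?thesis unfolding graph_type_def by blast
qed

lemma graph_type_subset_of_path:
  assumes "A \<subseteq> {..<n}"
  shows "\<exists>\<mu>s. (\<forall>\<mu>\<in>set \<mu>s. \<mu> \<ge> 1) \<and>
    graph_type A {{i, Suc i} | i. i \<in> A \<and> Suc i \<in> A} (map Dynkin_A \<mu>s) \<and>
    sum_list \<mu>s + length \<mu>s \<le> n + 1"
  using assms
proof (induction rule: interval_run_induct)
  case (initial n)
  show ?case
  proof (cases "n = 0")
    case True
    \<comment> \<open>The empty path gets the empty list and not \<open>[0]\<close>, since all
      entries must be positive.\<close>
    then show ?thesis using graph_type_Nil by (intro exI[of _ "[]"]) auto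
  next
    case False
    have "{{i, Suc i} | i. i \<in> {..<n} \<and> Suc i \<in> {..<n}} = {{i, Suc i} | i. 0 \<le> i \<and> Suc i < 0 + n}"
      by auto
    with False show ?thesis using graph_type_interval[of 0 n]
      by (intro exI[of _ "[n]"]) (simp add: lessThan_atLeast0)
  qed
next
  case (skip n A)
  then show ?case by (auto intro: le_SucI)
next
  case (run m n A)
  then obtain \<mu>s where \<mu>s: "\<forall>\<mu>\<in>set \<mu>s. \<mu> \<ge> 1"
    "graph_type A {{i, Suc i} | i. i \<in> A \<and> Suc i \<in> A} (map Dynkin_A \<mu>s)"
    "sum_list \<mu>s + length \<mu>s \<le> m + 1" by blast
  let ?k = "n - Suc m"
  have k: "Suc m + ?k = n" using \<open>Suc m < n\<close> by simp
  have "graph_type (A \<union> {Suc m..<n})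
    ({{i, Suc i} | i. i \<in> A \<and> Suc i \<in> A} \<union> {{i, Suc i} | i. Suc m \<le> i \<and> Suc i < n})
    (map Dynkin_A \<mu>s @ [Dynkin_A ?k])"
    using \<mu>s(2) graph_type_interval[of "Suc m" ?k, unfolded k] \<open>A \<subseteq> {..<m}\<close>
    by (intro graph_type_append) auto
  \<comment> \<open>The index \<open>m\<close> lies in neither set, so no edge joins the old
    vertices to the new run.\<close>
  moreover have "{{i, Suc i} | i. i \<in> A \<and> Suc i \<in> A} \<union> {{i, Suc i} | i. Suc m \<le> i \<and> Suc i < n} =
    {{i, Suc i} | i. i \<in> A \<union> {Suc m..<n} \<and> Suc i \<in> A \<union> {Suc m..<n}}"
  proof -
    have "(i \<in> A \<and> Suc i \<in> A) \<or> (Suc m \<le> i \<and> Suc i < n) \<longleftrightarrow>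
        i \<in> A \<union> {Suc m..<n} \<and> Suc i \<in> A \<union> {Suc m..<n}" for i
      using \<open>A \<subseteq> {..<m}\<close> by auto
    then show ?thesis by blast
  qed
  \<comment> \<open>The new run adds \<open>n - Suc m\<close> to the sum and 1 to the length, hence
    \<open>n - m\<close> in total, which turns the bound \<open>m + 1\<close> into
    \<open>n + 1\<close>.\<close>
  ultimately show ?case using \<mu>s \<open>Suc m < n\<close> by (intro exI[of _ "\<mu>s @ [?k]"]) auto
qed

section \<open>Separated subchains and arbitrary sets of vertices\<close>

lemma separated_intervals_exist:
  assumes "A \<subseteq> {..<n}"
  shows "\<exists>K :: nat set set.
     (\<forall>I\<in>K. \<exists>i j. i \<le> j \<and> j < n \<and> I = {i..j}) \<and> disjoint K \<and>
     (\<forall>I\<in>K. \<forall>J\<in>K. I \<noteq> J \<longrightarrow> (\<forall>i\<in>I. \<forall>j\<in>J. i < j \<longrightarrow> (\<exists>k. i < k \<and> k < j \<and> k \<notin> \<Union>K))) \<and>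
     \<Union>K = A"
  using assms
proof (induction rule: interval_run_induct)
  case (initial n)
  show ?case
  proof (cases n)
    case 0
    then show ?thesis by (intro exI[of _ "{}"]) auto
  next
    case (Suc l)
    then have "{..<n} = {0..l}" by auto
    then show ?thesis using Suc by (intro exI[of _ "{{0..l}}"]) auto
  qed
next
  case (skip n A)
  then obtain K where "\<forall>I\<in>K. \<exists>i j. i \<le> j \<and> j < n \<and> I = {i..j}" "disjoint K"
    "\<forall>I\<in>K. \<forall>J\<in>K. I \<noteq> J \<longrightarrow> (\<forall>i\<in>I. \<forall>j\<in>J. i < j \<longrightarrow> (\<exists>k. i < k \<and> k < j \<and> k \<notin> \<Union>K))"
    "\<Union>K = A" by blast
  then show ?case by (intro exI[of _ K]) (auto 0 3 intro: less_SucI)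
next
  case (run m n A)
  then obtain K where K: "\<forall>I\<in>K. \<exists>i j. i \<le> j \<and> j < m \<and> I = {i..j}" "disjoint K"
    "\<forall>I\<in>K. \<forall>J\<in>K. I \<noteq> J \<longrightarrow> (\<forall>i\<in>I. \<forall>j\<in>J. i < j \<longrightarrow> (\<exists>k. i < k \<and> k < j \<and> k \<notin> A))"
    "\<Union>K = A" by metis
  let ?J = "{Suc m..<n}" and ?U = "A \<union> {Suc m..<n}"
  have lt: "i < m" if "I \<in> K" "i \<in> I" for I i using that K(4) \<open>A \<subseteq> {..<m}\<close> by auto
  have J: "?J = {Suc m..n - 1}" using \<open>Suc m < n\<close> by auto
  have U: "\<Union>(insert ?J K) = ?U" using K(4) by auto
  have intervals: "\<forall>I\<in>insert ?J K. \<exists>i j. i \<le> j \<and> j < n \<and> I = {i..j}"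
  proof
    fix I assume "I \<in> insert ?J K"
    then show "\<exists>i j. i \<le> j \<and> j < n \<and> I = {i..j}"
    proof
      assume "I = ?J"
      then show ?thesis using J \<open>Suc m < n\<close> by (intro exI[of _ "Suc m"] exI[of _ "n - 1"]) auto
    next
      assume "I \<in> K"
      then obtain i j where "i \<le> j" "j < m" "I = {i..j}" using K(1) by blast
      then show ?thesis using \<open>Suc m < n\<close> by (intro exI[of _ i] exI[of _ j]) auto
    qed
  qed
  have disj: "disjoint (insert ?J K)"
    using K(2) lt by (fastforce simp: disjoint_def)
  \<comment> \<open>As \<open>i < j\<close>, the interval containing \<open>j\<close> decides. If it
    is an old one, then so is the interval of \<open>i\<close>, and the old gap lies below
    \<open>m\<close>, outside the new run. If it is the new run, then \<open>m\<close> itself is the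
    gap.\<close>
  have gap: "\<exists>k. i < k \<and> k < j \<and> k \<notin> ?U"
    if prems: "I \<in> insert ?J K" "J \<in> insert ?J K" "I \<noteq> J" "i \<in> I" "j \<in> J" "i < j" for I J i j
  proof (cases "J \<in> K")
    case True
    then have "j < m" using lt prems(5) by blast
    then have "i < m" using prems(6) by simp
    then have "I \<noteq> ?J" using prems(4) by auto
    then have "I \<in> K" using prems(1) by blast
    then obtain k where "i < k" "k < j" "k \<notin> A" using K(3) True prems(3-6) by metis
    then show ?thesis using \<open>j < m\<close> by (intro exI[of _ k]) auto
  next
    case False
    then have "J = ?J" "I \<in> K" using prems(1-3) by blast+
    then have "i < m" "m < j" using lt[OF _ prems(4)] prems(5) by auto
    then show ?thesis using \<open>A \<subseteq> {..<m}\<close> by (intro exI[of _ m]) auto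
  qed
  have "\<forall>I\<in>insert ?J K. \<forall>J\<in>insert ?J K. I \<noteq> J \<longrightarrow>
      (\<forall>i\<in>I. \<forall>j\<in>J. i < j \<longrightarrow> (\<exists>k. i < k \<and> k < j \<and> k \<notin> \<Union>(insert ?J K)))"
    unfolding U by (intro ballI impI) (rule gap)
  then show ?case by (intro exI[of _ "insert ?J K"] conjI intervals disj U)
qed

text \<open>One direction forgets the intervals; the other recovers them as the maximal runs of
  \<open>A\<close>. Separation is thus no restriction on the union, because adjacent intervals merge
  into a longer one.\<close>

lemma subchain_union_iff:
  "subchain_union xs R \<longleftrightarrow> (\<exists>A\<subseteq>{..<length xs}. R = mset_set ((!) xs ` A))"
proof
  assume "subchain_union xs R"
  then obtain K where K: "\<forall>I\<in>K. \<exists>i j. i \<le> j \<and> j < length xs \<and> I = {i..j}"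
    "R = mset_set ((!) xs ` \<Union>K)" unfolding subchain_union_def by blast
  then have "\<Union>K \<subseteq> {..<length xs}" by fastforce
  then show "\<exists>A\<subseteq>{..<length xs}. R = mset_set ((!) xs ` A)" using K(2) by blast
next
  assume "\<exists>A\<subseteq>{..<length xs}. R = mset_set ((!) xs ` A)"
  then obtain A where A: "A \<subseteq> {..<length xs}" "R = mset_set ((!) xs ` A)" by blast
  from separated_intervals_exist[OF A(1)] show "subchain_union xs R"
    unfolding subchain_union_def using A(2) by metis
qed

text \<open>This removes index intervals from the question of uniqueness, which becomes one about
  intersecting a set of curves with each chain.\<close>

lemma subchain_union_iff_subset:
  "subchain_union xs R \<longleftrightarrow> (\<exists>V\<subseteq>set xs. R = mset_set V)"
proof -
  have "set xs = (!) xs ` {..<length xs}" by (auto simp: set_conv_nth)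
  then have "(\<exists>A\<subseteq>{..<length xs}. V = (!) xs ` A) \<longleftrightarrow> V \<subseteq> set xs" for V
    by (simp add: subset_image_iff)
  then show ?thesis unfolding subchain_union_iff by metis
qed

section \<open>Divisors supported on a chain of curves\<close>

lemma subchain_union_subset: "subchain_union xs R \<Longrightarrow> set_mset R \<subseteq> set xs"
  using finite_subset[of _ "set xs"] unfolding subchain_union_iff_subset by auto

text \<open>Isolates the geometric input on a branch, namely which curves meet. A single curve
  satisfies it trivially, so \<open>[S1]\<close> can be treated like the two longer
  branches.\<close>

definition meets_as_chain :: "'b set list \<Rightarrow> bool" where
  "meets_as_chain xs \<longleftrightarrow> distinct xs \<and>
     (\<forall>i<length xs. \<forall>j<length xs. i \<noteq> j \<longrightarrow> (xs ! i \<inter> xs ! j \<noteq> {} \<longleftrightarrow> j = Suc i \<or> i = Suc j))"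

text \<open>Indexing by \<open>xs\<close> is a graph isomorphism from the subgraph of the integer
  path induced on \<open>A\<close> onto the dual graph of \<open>R\<close>. Type and bound are
  transported from \<open>graph_type_subset_of_path\<close>.\<close>

lemma subchain_union_divisor_type:
  fixes R :: "'k::field eff_divisor"
  assumes chain: "meets_as_chain xs" and "subchain_union xs R"
  shows "\<exists>\<mu>s. (\<forall>\<mu>\<in>set \<mu>s. \<mu> \<ge> 1) \<and> divisor_type R (map Dynkin_A \<mu>s) \<and>
    sum_list \<mu>s + length \<mu>s \<le> length xs + 1"
proof -
  obtain A where A: "A \<subseteq> {..<length xs}" and R: "R = mset_set ((!) xs ` A)"
    using assms(2) unfolding subchain_union_iff by blast
  \<comment> \<open>\<open>mset_set\<close> of an infinite set is zero by convention, so reading off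
    the support requires finiteness.\<close>
  have "finite A" using A finite_subset by blast
  then have set: "set_mset R = (!) xs ` A" using R by simp
  have inj: "inj_on ((!) xs) A"
    using chain A by (auto simp: meets_as_chain_def inj_on_def nth_eq_iff_index_eq subset_iff)
  have meet: "xs ! i \<inter> xs ! j \<noteq> {} \<longleftrightarrow> j = Suc i \<or> i = Suc j" if "i \<in> A" "j \<in> A" "i \<noteq> j" for i j
    using that A chain unfolding meets_as_chain_def by blast
  have edges: "dual_edges R = (`) ((!) xs) ` {{i, Suc i} | i. i \<in> A \<and> Suc i \<in> A}" (is "_ = ?G")
  proof
    show "dual_edges R \<subseteq> ?G"
    proof
      fix e assume "e \<in> dual_edges R"
      then obtain i j where ij: "i \<in> A" "j \<in> A" "i \<noteq> j" "e = {xs ! i, xs ! j}"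
        "xs ! i \<inter> xs ! j \<noteq> {}" unfolding dual_edges_def set by blast
      \<comment> \<open>Edges are unordered, so either curve may be the one with the smaller
        index.\<close>
      then consider "j = Suc i" | "i = Suc j" using meet by blast
      then show "e \<in> ?G"
      proof cases
        case 1
        then have "e = (!) xs ` {i, Suc i}" using ij by simp
        then show ?thesis using ij 1 by blast
      next
        case 2
        then have "e = (!) xs ` {j, Suc j}" using ij by auto
        then show ?thesis using ij 2 by blast
      qed
    qed
    show "?G \<subseteq> dual_edges R"
    proof
      fix e assume "e \<in> ?G"
      then obtain i where i: "i \<in> A" "Suc i \<in> A" "e = {xs ! i, xs ! Suc i}" by auto
      moreover from i have "xs ! i \<inter> xs ! Suc i \<noteq> {}" using meet by simp
      moreover have "xs ! i \<noteq> xs ! Suc i" using inj_onD[OF inj _ i(1,2)] by auto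
      ultimately show "e \<in> dual_edges R" unfolding dual_edges_def set by blast
    qed
  qed
  obtain \<mu>s where \<mu>s: "\<forall>\<mu>\<in>set \<mu>s. \<mu> \<ge> 1" "sum_list \<mu>s + length \<mu>s \<le> length xs + 1"
    "graph_type A {{i, Suc i} | i. i \<in> A \<and> Suc i \<in> A} (map Dynkin_A \<mu>s)"
    using graph_type_subset_of_path[OF A] by blast
  have "divisor_type R (map Dynkin_A \<mu>s)"
    unfolding divisor_type_def set edges by (rule graph_type_image[OF \<mu>s(3) inj])
  then show ?thesis using \<mu>s(1,2) by blast
qed

lemma divisor_type_zero_iff: "divisor_type R [] \<longleftrightarrow> R = {#}"
  by (auto simp: divisor_type_def graph_type_def bij_betw_def dual_edges_def)

text \<open>Since no curve of one divisor meets a curve of the other, the sum acquires no new dual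
  edges. The absence of common components is a separate assumption: \<open>disjoint_divisors\<close>
  alone would let the empty set be a component of both.\<close>

lemma divisor_type_add:
  fixes R R' :: "'k::field eff_divisor"
  assumes "divisor_type R ts" "divisor_type R' us" "disjoint_divisors R R'"
    and disj: "set_mset R \<inter> set_mset R' = {}"
  shows "divisor_type (R + R') (ts @ us)"
proof -
  have "dual_edges (R + R') = dual_edges R \<union> dual_edges R'"
  proof
    show "dual_edges (R + R') \<subseteq> dual_edges R \<union> dual_edges R'"
    proof
      fix e assume "e \<in> dual_edges (R + R')"
      then obtain Y Z where YZ: "e = {Y, Z}" "Y \<in># R + R'" "Z \<in># R + R'" "Y \<noteq> Z" "Y \<inter> Z \<noteq> {}"
        unfolding dual_edges_def by blast
      then have "(Y \<in># R \<and> Z \<in># R) \<or> (Y \<in># R' \<and> Z \<in># R')"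
        using assms(3) unfolding disjoint_divisors_def by (metis Int_commute union_iff)
      then show "e \<in> dual_edges R \<union> dual_edges R'" using YZ unfolding dual_edges_def by blast
    qed
  qed (auto simp: dual_edges_def)
  then show ?thesis
    using graph_type_append[of "set_mset R" "dual_edges R" ts "set_mset R'" "dual_edges R'" us]
      assms unfolding divisor_type_def by simp
qed

section \<open>Uniqueness of the decomposition by supports\<close>

lemma reduced_subdivisor_eq_mset_set:
  assumes "reduced_subdivisor F R"
  shows "R = mset_set (set_mset R)"
proof (rule multiset_eqI)
  fix x
  have "count R x \<le> 1" using assms unfolding reduced_subdivisor_def by blast
  then show "count R x = count (mset_set (set_mset R)) x"
    by (cases "x \<in># R") (simp_all add: le_antisym Suc_le_eq not_in_iff)
qed

text \<open>Restricting the sum to one of the disjoint sets keeps the summand supported there and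
  kills the other two, so each summand is recovered from \<open>V\<close>.\<close>

lemma unique_mset_decomposition:
  assumes V: "V \<subseteq> P \<union> Q \<union> T" and fin: "finite V"
    and disj: "P \<inter> Q = {}" "P \<inter> T = {}" "Q \<inter> T = {}"
  shows "mset_set V = RP + RQ + RT \<and> set_mset RP \<subseteq> P \<and> set_mset RQ \<subseteq> Q \<and> set_mset RT \<subseteq> T \<longleftrightarrow>
    RP = mset_set (V \<inter> P) \<and> RQ = mset_set (V \<inter> Q) \<and> RT = mset_set (V \<inter> T)"
proof
  assume R: "mset_set V = RP + RQ + RT \<and> set_mset RP \<subseteq> P \<and> set_mset RQ \<subseteq> Q \<and> set_mset RT \<subseteq> T"
  have *: "mset_set (V \<inter> W) = filter_mset (\<lambda>x. x \<in> W) RP + filter_mset (\<lambda>x. x \<in> W) RQ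
      + filter_mset (\<lambda>x. x \<in> W) RT" for W
    using R fin by (metis filter_union_mset filter_mset_mset_set Int_def Collect_conj_eq
      Collect_mem_eq)
  have all: "filter_mset (\<lambda>x. x \<in> W) M = M" if "set_mset M \<subseteq> W" for W and M :: "'a multiset"
    using that by (intro multiset_eqI) (auto simp: count_eq_zero_iff)
  have none: "filter_mset (\<lambda>x. x \<in> W) M = {#}" if "set_mset M \<subseteq> W'" "W \<inter> W' = {}"
    for W W' and M :: "'a multiset"
    using that by (intro multiset_eqI) (auto simp: count_eq_zero_iff)
  show "RP = mset_set (V \<inter> P) \<and> RQ = mset_set (V \<inter> Q) \<and> RT = mset_set (V \<inter> T)"
  proof (intro conjI)
    show "RP = mset_set (V \<inter> P)"
      using R disj all[of RP P] none[of RQ Q P] none[of RT T P] by (simp add: *)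
    show "RQ = mset_set (V \<inter> Q)"
      using R disj all[of RQ Q] none[of RP P Q] none[of RT T Q]
      unfolding * by (simp add: Int_commute)
    show "RT = mset_set (V \<inter> T)"
      using R disj all[of RT T] none[of RP P T] none[of RQ Q T]
      unfolding * by (simp add: Int_commute)
  qed
next
  assume R: "RP = mset_set (V \<inter> P) \<and> RQ = mset_set (V \<inter> Q) \<and> RT = mset_set (V \<inter> T)"
  have "V = (V \<inter> P) \<union> (V \<inter> Q) \<union> (V \<inter> T)" using V by blast
  then have "mset_set V = mset_set ((V \<inter> P) \<union> (V \<inter> Q) \<union> (V \<inter> T))" by simp
  also have "\<dots> = mset_set ((V \<inter> P) \<union> (V \<inter> Q)) + mset_set (V \<inter> T)"
    using fin disj by (intro mset_set_Union) auto
  also have "mset_set ((V \<inter> P) \<union> (V \<inter> Q)) = mset_set (V \<inter> P) + mset_set (V \<inter> Q)"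
    using fin disj by (intro mset_set_Union) auto
  finally show "mset_set V = RP + RQ + RT \<and> set_mset RP \<subseteq> P \<and> set_mset RQ \<subseteq> Q \<and> set_mset RT \<subseteq> T"
    using R fin by simp
qed

text \<open>Equivalence with an explicit triple yields existence and uniqueness at once.\<close>

lemma subchain_union_decomposition:
  fixes RP RQ RT :: "'a multiset"
  assumes "V \<subseteq> set ps \<union> set qs \<union> set ts"
    and "set ps \<inter> set qs = {}" "set ps \<inter> set ts = {}" "set qs \<inter> set ts = {}"
  shows "mset_set V = RP + RQ + RT \<and>
      subchain_union ps RP \<and> subchain_union qs RQ \<and> subchain_union ts RT \<longleftrightarrow>
    RP = mset_set (V \<inter> set ps) \<and> RQ = mset_set (V \<inter> set qs) \<and> RT = mset_set (V \<inter> set ts)"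
    (is "?L \<longleftrightarrow> ?R")
proof -
  have "finite V" using assms(1) finite_subset by blast
  note unique = unique_mset_decomposition[OF assms(1) this assms(2-4)]
  show ?thesis
  proof
    assume ?L
    then show ?R using subchain_union_subset unique by blast
  next
    assume R: ?R
    have "subchain_union xs (mset_set (V \<inter> set xs))" for xs
      unfolding subchain_union_iff_subset by blast
    then show ?L using R iffD2[OF unique R] by simp
  qed
qed

section \<open>Incidence of the branches of the extended E8 diagram\<close>

lemma dual_edges_iff:
  "Y \<in># R \<Longrightarrow> Z \<in># R \<Longrightarrow> Y \<noteq> Z \<Longrightarrow> {Y, Z} \<in> dual_edges R \<longleftrightarrow> Y \<inter> Z \<noteq> {}"
  unfolding dual_edges_def by (auto simp: doubleton_eq_iff)

lemma E8_tilde_branches: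
  fixes F :: "'k::field eff_divisor"
  assumes "E8_tilde (set_mset F) (dual_edges F) C S1 M1 M2 L1 L2 L3 L4 L5"
  shows "meets_as_chain [M1, M2]" "meets_as_chain [L1, L2, L3, L4, L5]"
    and "\<forall>Y\<in>{M1, M2}. S1 \<inter> Y = {}" "\<forall>Z\<in>{L1, L2, L3, L4, L5}. S1 \<inter> Z = {}"
    and "\<forall>Y\<in>{M1, M2}. \<forall>Z\<in>{L1, L2, L3, L4, L5}. Y \<inter> Z = {}"
proof -
  note E = assms[unfolded E8_tilde_def]
  note dist = E[THEN conjunct1]
    and V = E[THEN conjunct2, THEN conjunct1]
    and edges = E[THEN conjunct2, THEN conjunct2]
  have meet: "Y \<inter> Z = {} \<longleftrightarrow>
      {Y, Z} \<notin> {{C, S1}, {C, M1}, {M1, M2}, {C, L1}, {L1, L2}, {L2, L3}, {L3, L4}, {L4, L5}}"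
    if "Y \<in> {C, S1, M1, M2, L1, L2, L3, L4, L5}" "Z \<in> {C, S1, M1, M2, L1, L2, L3, L4, L5}"
      "Y \<noteq> Z" for Y Z
    unfolding dual_edges_iff[of Y F Z, unfolded V edges, OF that] by (rule not_not[symmetric])
  \<comment> \<open>Unfolding \<open>distinct\<close> gives each inequality in one orientation only;
    the reversed list supplies the other one for the simplifier.\<close>
  have "distinct (rev [C, S1, M1, M2, L1, L2, L3, L4, L5])"
    using dist by (simp only: distinct_rev)
  note neq = dist[simplified] this[simplified]
  show "\<forall>Y\<in>{M1, M2}. S1 \<inter> Y = {}" "\<forall>Z\<in>{L1, L2, L3, L4, L5}. S1 \<inter> Z = {}"
    "\<forall>Y\<in>{M1, M2}. \<forall>Z\<in>{L1, L2, L3, L4, L5}. Y \<inter> Z = {}"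
    by (simp_all add: meet doubleton_eq_iff neq)
  show "meets_as_chain [M1, M2]" "meets_as_chain [L1, L2, L3, L4, L5]"
    unfolding meets_as_chain_def
    by (simp_all add: meet doubleton_eq_iff All_less_Suc numeral_eq_Suc neq)
qed

section \<open>Divisors that avoid the central component\<close>

theorem proposition12p1:
  fixes X B :: "'k::{alg_closed_field, field_char_0} pt set"
    and \<pi> :: "'k pt \<Rightarrow> 'k pt" and b :: "'k pt"
    and F :: "'k eff_divisor"
    and C S1 M1 M2 L1 L2 L3 L4 L5 :: "'k pt set"
  assumes "K3_surface X"
    and "elliptic_fibration X B \<pi>"
    and "is_fiber X B \<pi> b F"
    and "type_II_star X F"
    and "E8_tilde (set_mset F) (dual_edges F) C S1 M1 M2 L1 L2 L3 L4 L5"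
    and "F = replicate_mset 6 C + replicate_mset 3 S1 + replicate_mset 4 M1 + replicate_mset 2 M2
           + replicate_mset 5 L1 + replicate_mset 4 L2 + replicate_mset 3 L3
           + replicate_mset 2 L4 + {#L5#}"
  shows
    "(\<forall>R. ADER F R \<and> C \<notin># R \<longrightarrow>
        (\<exists>!(D :: 'k eff_divisor \<times> 'k eff_divisor \<times> 'k eff_divisor).
          case D of (RS, RM, RL) \<Rightarrow>
            R = RS + RM + RL \<and>
            disjoint_divisors RS RM \<and> disjoint_divisors RS RL \<and> disjoint_divisors RM RL \<and>
            RS \<in> {{#}, {#S1#}} \<and>
            subchain_union [M1, M2] RM \<and>
            subchain_union [L1, L2, L3, L4, L5] RL) \<and>
        (\<forall>RS RM RL.
            R = RS + RM + RL \<and>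
            disjoint_divisors RS RM \<and> disjoint_divisors RS RL \<and> disjoint_divisors RM RL \<and>
            RS \<in> {{#}, {#S1#}} \<and>
            subchain_union [M1, M2] RM \<and>
            subchain_union [L1, L2, L3, L4, L5] RL \<longrightarrow>
            (RM \<noteq> {#} \<longrightarrow>
              (\<exists>\<mu>s :: nat list. \<mu>s \<noteq> [] \<and> (\<forall>\<mu>\<in>set \<mu>s. \<mu> \<ge> 1) \<and>
                 divisor_type RM (map Dynkin_A \<mu>s) \<and> sum_list \<mu>s + length \<mu>s - 1 \<le> 2)) \<and>
            (RL \<noteq> {#} \<longrightarrow>
              (\<exists>\<nu>s :: nat list. \<nu>s \<noteq> [] \<and> (\<forall>\<nu>\<in>set \<nu>s. \<nu> \<ge> 1) \<and>
                 divisor_type RL (map Dynkin_A \<nu>s) \<and> sum_list \<nu>s + length \<nu>s - 1 \<le> 5)))) \<and>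
     (\<forall>RS RM RL.
        RS \<in> {{#}, {#S1#}} \<and>
        subchain_union [M1, M2] RM \<and>
        subchain_union [L1, L2, L3, L4, L5] RL \<and>
        RS + RM + RL \<noteq> {#} \<and> reduced_subdivisor F (RS + RM + RL) \<and>
        (RM \<noteq> {#} \<longrightarrow>
          (\<exists>\<mu>s :: nat list. \<mu>s \<noteq> [] \<and> (\<forall>\<mu>\<in>set \<mu>s. \<mu> \<ge> 1) \<and>
             divisor_type RM (map Dynkin_A \<mu>s) \<and> sum_list \<mu>s + length \<mu>s - 1 \<le> 2)) \<and>
        (RL \<noteq> {#} \<longrightarrow>
          (\<exists>\<nu>s :: nat list. \<nu>s \<noteq> [] \<and> (\<forall>\<nu>\<in>set \<nu>s. \<nu> \<ge> 1) \<and>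
             divisor_type RL (map Dynkin_A \<nu>s) \<and> sum_list \<nu>s + length \<nu>s - 1 \<le> 5)) \<longrightarrow>
        ADER F (RS + RM + RL))"
proof -
  define Ms where "Ms = [M1, M2]"
  define Ls where "Ls = [L1, L2, L3, L4, L5]"
  let ?type = "\<lambda>R ts. (\<forall>\<mu>\<in>set ts. \<mu> \<ge> 1) \<and> divisor_type R (map Dynkin_A ts)"
  let ?dec = "\<lambda>R RS RM RL. R = RS + RM + RL \<and>
    disjoint_divisors RS RM \<and> disjoint_divisors RS RL \<and> disjoint_divisors RM RL \<and>
    RS \<in> {{#}, {#S1#}} \<and> subchain_union Ms RM \<and> subchain_union Ls RL"
  note E8 = assms(5)[unfolded E8_tilde_def]
  have chains: "meets_as_chain Ms" "meets_as_chain Ls" "meets_as_chain [S1]"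
    using E8_tilde_branches(1,2)[OF assms(5)]
    by (simp_all add: Ms_def Ls_def meets_as_chain_def[of "[S1]"])
  have separate: "\<forall>Y\<in>set [S1]. \<forall>Z\<in>set Ms. Y \<inter> Z = {}"
    "\<forall>Y\<in>set [S1]. \<forall>Z\<in>set Ls. Y \<inter> Z = {}"
    "\<forall>Y\<in>set Ms. \<forall>Z\<in>set Ls. Y \<inter> Z = {}"
    using E8_tilde_branches(3-5)[OF assms(5)] by (simp_all add: Ms_def Ls_def)
  have F: "set_mset F = insert C (set [S1] \<union> set Ms \<union> set Ls)"
    using E8[THEN conjunct2, THEN conjunct1] by (simp add: Ms_def Ls_def insert_commute)
  have sets: "set [S1] \<inter> set Ms = {}" "set [S1] \<inter> set Ls = {}" "set Ms \<inter> set Ls = {}"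
    using E8[THEN conjunct1] by (auto simp: Ms_def Ls_def)
  \<comment> \<open>The third branch becomes a chain of length one, so all three summands fall under
    the same lemmas.\<close>
  have S1: "RS \<in> {{#}, {#S1#}} \<longleftrightarrow> subchain_union [S1] RS" for RS
    by (simp add: subchain_union_iff_subset subset_singleton_iff ex_disj_distrib conj_disj_distribR)
  \<comment> \<open>Curves on different branches never meet, so the disjointness clauses follow from
    the supports.\<close>
  have disj: "disjoint_divisors RS RM" "disjoint_divisors RS RL" "disjoint_divisors RM RL"
    if "subchain_union [S1] RS" "subchain_union Ms RM" "subchain_union Ls RL" for RS RM RL
    using that[THEN subchain_union_subset] separate unfolding disjoint_divisors_def by blast+
  have chain_type: "\<exists>\<mu>s. \<mu>s \<noteq> [] \<and> ?type R \<mu>s \<and> sum_list \<mu>s + length \<mu>s - 1 \<le> length xs"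
    if prems: "meets_as_chain xs" "subchain_union xs R" "R \<noteq> {#}" for xs and R :: "'k eff_divisor"
  proof -
    obtain \<mu>s where "?type R \<mu>s" "sum_list \<mu>s + length \<mu>s \<le> length xs + 1"
      using subchain_union_divisor_type[OF prems(1,2)] by blast
    \<comment> \<open>A nonzero divisor cannot have the empty list as its type. Hence the
      subtraction of 1 in the bound is not truncated.\<close>
    moreover from this have "\<mu>s \<noteq> []" using prems(3) divisor_type_zero_iff by force
    ultimately show ?thesis by (intro exI[of _ \<mu>s]) auto
  qed
  have decomposition: "\<exists>!D. case D of (RS, RM, RL) \<Rightarrow> ?dec R RS RM RL"
    if prems: "ADER F R" "C \<notin># R" for R
  proof -
    define V where "V = set_mset R"
    have red: "reduced_subdivisor F R" using prems(1) unfolding ADER_def by blast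
    then have R: "R = mset_set V" unfolding V_def by (rule reduced_subdivisor_eq_mset_set)
    have "V \<subseteq> set_mset F"
      using red set_mset_mono unfolding reduced_subdivisor_def V_def by blast
    then have V: "V \<subseteq> set [S1] \<union> set Ms \<union> set Ls"
      using prems(2) unfolding F V_def by blast
    \<comment> \<open>The only candidate is the triple of intersections of the support with the
      three branches.\<close>
    have "?dec R RS RM RL \<longleftrightarrow> RS = mset_set (V \<inter> set [S1]) \<and> RM = mset_set (V \<inter> set Ms) \<and>
        RL = mset_set (V \<inter> set Ls)" for RS RM RL
      unfolding R S1 subchain_union_decomposition[OF V sets, symmetric] using disj by blast
    then have "(case D of (RS, RM, RL) \<Rightarrow> ?dec R RS RM RL) \<longleftrightarrow>
        D = (mset_set (V \<inter> set [S1]), mset_set (V \<inter> set Ms), mset_set (V \<inter> set Ls))" for D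
      by (cases D) (simp only: prod.case prod.inject)
    then show ?thesis by (simp only: ex1_eq)
  qed
  have converse: "ADER F (RS + RM + RL)"
    if prems: "RS \<in> {{#}, {#S1#}}" "subchain_union Ms RM" "subchain_union Ls RL"
      "RS + RM + RL \<noteq> {#}" "reduced_subdivisor F (RS + RM + RL)" for RS RM RL
  proof -
    have S: "subchain_union [S1] RS" using prems(1) S1 by blast
    \<comment> \<open>Each summand, zero or not, has a list of diagrams of type A. The lists can be
      concatenated because different branches neither meet nor share a component.\<close>
    obtain ss where ss: "?type RS ss" using subchain_union_divisor_type[OF chains(3) S] by blast
    obtain ms where ms: "?type RM ms"
      using subchain_union_divisor_type[OF chains(1) prems(2)] by blast
    obtain ls where ls: "?type RL ls"
      using subchain_union_divisor_type[OF chains(2) prems(3)] by blast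
    note disj = disj[OF S prems(2,3)]
    note subs = S[THEN subchain_union_subset] prems(2,3)[THEN subchain_union_subset]
    have "set_mset RS \<inter> set_mset RM = {}" using subs sets by blast
    then have "divisor_type (RS + RM) (map Dynkin_A ss @ map Dynkin_A ms)"
      using divisor_type_add[OF ss[THEN conjunct2] ms[THEN conjunct2] disj(1)] by blast
    moreover have "disjoint_divisors (RS + RM) RL"
      using disj unfolding disjoint_divisors_def set_mset_union by blast
    moreover have "set_mset (RS + RM) \<inter> set_mset RL = {}"
      using subs sets unfolding set_mset_union by blast
    ultimately have
      "divisor_type (RS + RM + RL) ((map Dynkin_A ss @ map Dynkin_A ms) @ map Dynkin_A ls)"
      using divisor_type_add[OF _ ls[THEN conjunct2]] by blast
    moreover have "\<forall>t\<in>set ((map Dynkin_A ss @ map Dynkin_A ms) @ map Dynkin_A ls).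
        dynkin_valid t"
      using ss ms ls by auto
    ultimately show ?thesis using prems(4,5) unfolding ADER_def by blast
  qed
  have lengths: "length Ms = 2" "length Ls = 5" by (simp_all add: Ms_def Ls_def)
  have typed: "(RM \<noteq> {#} \<longrightarrow> (\<exists>\<mu>s. \<mu>s \<noteq> [] \<and> (\<forall>\<mu>\<in>set \<mu>s. \<mu> \<ge> 1) \<and>
        divisor_type RM (map Dynkin_A \<mu>s) \<and> sum_list \<mu>s + length \<mu>s - 1 \<le> 2)) \<and>
      (RL \<noteq> {#} \<longrightarrow> (\<exists>\<nu>s. \<nu>s \<noteq> [] \<and> (\<forall>\<nu>\<in>set \<nu>s. \<nu> \<ge> 1) \<and>
        divisor_type RL (map Dynkin_A \<nu>s) \<and> sum_list \<nu>s + length \<nu>s - 1 \<le> 5))"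
    if "subchain_union Ms RM" "subchain_union Ls RL" for RM RL
    using chain_type[OF chains(1) that(1)] chain_type[OF chains(2) that(2)] unfolding lengths by blast
  show ?thesis
    unfolding Ms_def[symmetric] Ls_def[symmetric]
    apply (rule conjI)
    subgoal
      apply (intro allI impI, elim conjE, rule conjI)
      subgoal by (rule decomposition)
      subgoal by (intro allI impI, elim conjE, rule typed)
      done
    subgoal by (intro allI impI, elim conjE, rule converse)
    done
qed

end
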